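(* For all integers $n\ge 1$, $$(x^2+qs)\,D\,U_{n-1}(x,q^2s,q)+q^{n-1}x\,U_{n-1}(x,s,q)=[n]\,T_n(x,s,q).$$
   Context: Here $x,s,q$ are indeterminates. $D$ is the $q$-differentiation operator with respect to $x$, $Df(x)=\frac{f(x)-f(qx)}{x-qx}$; $D\,U_{n-1}(x,q^2s,q)$ means $D$ applied to the polynomial $x\mapsto U_{n-1}(x,q^2s,q)$. Notation: $(a;q)_n=\prod_{j=0}^{n-1}(1-q^ja)$; $\begin{bmatrix} n\\k\end{bmatrix}=\frac{(q;q)_n}{(q;q)_k(q;q)_{n-k}}$ for $0\le k\le n$; $[n]=\frac{1-q^n}{1-q}$. The $q$-Chebyshev polynomials of the second kind are, for $n\ge0$, $$U_n(x,s,q)=\sum_{k=0}^{\lfloor n/2\rfloor}q^{k^2}\begin{bmatrix} n-k\\k\end{bmatrix}(1+q^{k+1})\cdots(1+q^{n-k})\,s^kx^{n-2k}.$$ The $q$-Chebyshev polynomials of the first kind are $T_0(x,s,q)=1$ and, for $n>0$, $$T_n(x,s,q)=\sum_{k=0}^{\lfloor n/2\rfloor}q^{k^2}\frac{[n]}{[n-k]}\begin{bmatrix} n-k\\k\end{bmatrix}\frac{(-q;q)_{n-1}}{(-q;q)_k\,(-q^{n-k};q)_k}\,s^kx^{n-2k}.$$ *)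

theory Defs
  imports
    Complex_Main
    "HOL-Computational_Algebra.Polynomial_Factorial"
begin

definition q_int :: "'a::field \<Rightarrow> nat \<Rightarrow> 'a" where
  "q_int q n = (1 - q ^ n) / (1 - q)"

definition q_poch :: "'a::field \<Rightarrow> 'a \<Rightarrow> nat \<Rightarrow> 'a" where
  "q_poch a q n = (\<Prod>j<n. 1 - q ^ j * a)"

definition q_binom :: "'a::field \<Rightarrow> nat \<Rightarrow> nat \<Rightarrow> 'a" where
  "q_binom q n k = (if k \<le> n then q_poch q q n / (q_poch q q k * q_poch q q (n - k)) else 0)"

definition q_cheb_U :: "nat \<Rightarrow> 'a::field \<Rightarrow> 'a \<Rightarrow> 'a \<Rightarrow> 'a" where
  "q_cheb_U n x s q =
     (\<Sum>k = 0..n div 2. q ^ (k\<^sup>2) * q_binom q (n - k) k * (\<Prod>j = k + 1..n - k. 1 + q ^ j)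
                        * s ^ k * x ^ (n - 2 * k))"

definition q_cheb_T :: "nat \<Rightarrow> 'a::field \<Rightarrow> 'a \<Rightarrow> 'a \<Rightarrow> 'a" where
  "q_cheb_T n x s q =
     (if n = 0 then 1
      else \<Sum>k = 0..n div 2. q ^ (k\<^sup>2) * (q_int q n / q_int q (n - k)) * q_binom q (n - k) k
             * (q_poch (- q) q (n - 1) / (q_poch (- q) q k * q_poch (- (q ^ (n - k))) q k))
             * s ^ k * x ^ (n - 2 * k))"

definition q_deriv :: "'a::field \<Rightarrow> ('a \<Rightarrow> 'a) \<Rightarrow> 'a \<Rightarrow> 'a" where
  "q_deriv q f x = (f x - f (q * x)) / (x - q * x)"

text \<open>
  The indeterminates, as elements of the field K(q,s,x) of rational functions over an arbitrary
  field K, represented as the fraction field of K[q][s][x]: the innermost polynomial variable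
  is q, the outermost one is x.  None of the denominators above vanishes at these elements.
  For f given by a polynomial expression, q_deriv q f x at the indeterminate x is the
  q-derivative of that polynomial with respect to x.
\<close>

definition q_ind :: "'a::field poly poly poly fract" where
  "q_ind = to_fract [:[:[:0, 1:]:]:]"

definition s_ind :: "'a::field poly poly poly fract" where
  "s_ind = to_fract [:[:0, 1:]:]"

definition x_ind :: "'a::field poly poly poly fract" where
  "x_ind = to_fract [:0, 1:]"

end

theory Submission
  imports Defs
begin

text \<open>
  Both sides are polynomials in \<open>x\<close> and \<open>s\<close> that are homogeneous when \<open>s\<close> has weight 2, so it
  suffices to compare the coefficients of \<open>s ^ k * x ^ (n - 2 * k)\<close>.  With \<open>n = 2 * k + r\<close> and
  \<open>m = k + r\<close>, put
  \<open>G = q ^ k\<^sup>2 * (q\<^sup>2; q\<^sup>2)_(m - 1) / ((q\<^sup>2; q\<^sup>2)_k * (q; q)_r)\<close>.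
  The rows \<open>n - 1\<close> of \<open>U\<close> and \<open>n\<close> of \<open>T\<close> are simple multiples of \<open>G\<close>, because
  \<open>(q; q)_j * (-q; q)_j = (q\<^sup>2; q\<^sup>2)_j\<close> merges every \<open>q\<close>-binomial coefficient with the product
  \<open>(1 + q ^ (k + 1)) \<cdots>\<close> next to it: the \<open>k\<close>-th coefficient of \<open>U\<close> is \<open>G * (1 - q ^ r)\<close>
  (\<open>cheb_U_coeff_pred\<close>), that of \<open>T\<close> is \<open>G * (1 - q ^ n)\<close> (\<open>cheb_T_coeff_closed\<close>), and the one
  of \<open>U\<close> at \<open>k - 1\<close>, which the summand \<open>q * s * D U\<close> shifts to position \<open>k\<close>, contributes
  \<open>G * (1 - q ^ (2 * m)) * (1 - q ^ (2 * k)) / (1 - q)\<close> (\<open>cheb_U_coeff_shifted\<close>).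
  For \<open>r > 0\<close> one has \<open>q ^ (2 * k) * [r - 1] + q ^ (n - 1) = q ^ (2 * k) * [r]\<close>, and for
  \<open>r = 0\<close> the factor \<open>1 - q ^ r\<close> vanishes; so cancelling \<open>G / (1 - q)\<close> leaves
  \<open>q ^ (2 * k) * (1 - q ^ r)\<^sup>2 + (1 - q ^ (2 * m)) * (1 - q ^ (2 * k)) = (1 - q ^ n)\<^sup>2\<close>,
  which is immediate by expansion.

  The argument runs over any field in which \<open>x\<close> is nonzero and \<open>q\<close> is not a root of unity.
  The latter also makes each \<open>1 + q ^ j\<close> with \<open>j > 0\<close> nonzero, in any characteristic,
  as it divides \<open>1 - q ^ (2 * j)\<close>; hence all denominators can be cleared.
\<close>

section \<open>Coefficients, \<open>q\<close>-shifted factorials and \<open>q\<close>-derivatives\<close>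

definition cheb_U_coeff :: "'a::field \<Rightarrow> nat \<Rightarrow> nat \<Rightarrow> 'a" where
  "cheb_U_coeff q n k = q ^ (k\<^sup>2) * q_binom q (n - k) k * (\<Prod>j = k + 1..n - k. 1 + q ^ j)"

definition cheb_T_coeff :: "'a::field \<Rightarrow> nat \<Rightarrow> nat \<Rightarrow> 'a" where
  "cheb_T_coeff q n k = q ^ (k\<^sup>2) * (q_int q n / q_int q (n - k)) * q_binom q (n - k) k
     * (q_poch (- q) q (n - 1) / (q_poch (- q) q k * q_poch (- (q ^ (n - k))) q k))"

lemma q_int_0 [simp]: "q_int q 0 = 0"
  by (simp add: q_int_def)

lemma q_poch_0 [simp]: "q_poch a q 0 = 1"
  by (simp add: q_poch_def)

lemma q_poch_Suc: "q_poch a q (Suc n) = q_poch a q n * (1 - q ^ n * a)"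
  by (simp add: q_poch_def)

lemma q_poch_add: "q_poch a q (m + n) = q_poch a q m * q_poch (q ^ m * a) q n"
  by (induction n) (simp_all add: q_poch_Suc power_add mult_ac)

lemma q_poch_mult_minus: "q_poch q q m * q_poch (- q) q m = q_poch (q\<^sup>2) (q\<^sup>2) m"
proof (induction m)
  case (Suc m)
  have "(1 - q ^ m * q) * (1 + q ^ m * q) = 1 - (q\<^sup>2) ^ m * q\<^sup>2"
    by (simp add: algebra_simps power2_eq_square power_mult_distrib)
  moreover have "q_poch q q (Suc m) * q_poch (- q) q (Suc m)
      = q_poch q q m * q_poch (- q) q m * ((1 - q ^ m * q) * (1 + q ^ m * q))"
    by (simp add: q_poch_Suc)
  ultimately show ?case
    by (simp only: Suc.IH q_poch_Suc)
qed simp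

lemma prod_one_plus_power:
  assumes "k \<le> m"
  shows "q_poch (- q) q k * (\<Prod>j = k + 1..m. 1 + q ^ j) = q_poch (- q) q m"
  using assms
proof (induction m rule: dec_induct)
  case base
  then show ?case by simp
next
  case (step m)
  then show ?case by (simp add: q_poch_Suc power_commutes flip: mult.assoc)
qed

text \<open>
  The vanishing of the \<open>q\<close>-binomial coefficient beyond \<open>n div 2\<close> allows all the sums in the
  identity to be taken over one common range.
\<close>

lemma q_cheb_U_eq_sum:
  assumes "n div 2 \<le> M"
  shows "q_cheb_U n x s q = (\<Sum>k\<le>M. cheb_U_coeff q n k * s ^ k * x ^ (n - 2 * k))"
proof -
  have "cheb_U_coeff q n k = 0" if "k \<notin> {0..n div 2}" for k
    using that by (auto simp: cheb_U_coeff_def q_binom_def)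
  then have "(\<Sum>k = 0..n div 2. cheb_U_coeff q n k * s ^ k * x ^ (n - 2 * k))
           = (\<Sum>k\<le>M. cheb_U_coeff q n k * s ^ k * x ^ (n - 2 * k))"
    using assms by (intro sum.mono_neutral_left) auto
  then show ?thesis
    by (simp add: q_cheb_U_def cheb_U_coeff_def)
qed

lemma q_cheb_T_eq_sum:
  assumes "n > 0"
  shows "q_cheb_T n x s q = (\<Sum>k\<le>n div 2. cheb_T_coeff q n k * s ^ k * x ^ (n - 2 * k))"
  using assms by (simp add: q_cheb_T_def cheb_T_coeff_def atLeast0AtMost)

lemma q_deriv_sum_powers:
  assumes "q \<noteq> 1" and "x \<noteq> 0"
  shows "q_deriv q (\<lambda>y. \<Sum>k\<in>A. c k * y ^ e k) x = (\<Sum>k\<in>A. c k * q_int q (e k) * x ^ (e k - 1))"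
proof -
  have mono: "(x ^ m - (q * x) ^ m) / (x - q * x) = q_int q m * x ^ (m - 1)" for m
  proof (cases m)
    case (Suc l)
    have "x - q * x = (1 - q) * x"
      by (simp add: algebra_simps)
    moreover have "x ^ m - (q * x) ^ m = (1 - q ^ m) * x ^ l * x"
      using Suc by (simp add: algebra_simps power_mult_distrib)
    ultimately show ?thesis
      using assms Suc by (simp add: q_int_def)
  qed simp
  have "q_deriv q (\<lambda>y. \<Sum>k\<in>A. c k * y ^ e k) x
      = (\<Sum>k\<in>A. c k * ((x ^ e k - (q * x) ^ e k) / (x - q * x)))"
    unfolding q_deriv_def
    by (simp add: sum_divide_distrib right_diff_distrib diff_divide_distrib flip: sum_subtractf)
  then show ?thesis
    by (simp add: mono mult.assoc)
qed

section \<open>Closed forms when \<open>q\<close> is not a root of unity\<close>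

context
  fixes q :: "'a::field"
  assumes not_root_of_unity: "\<And>j. j > 0 \<Longrightarrow> q ^ j \<noteq> 1"
begin

lemma q_ne_1: "q \<noteq> 1"
  using not_root_of_unity[of 1] by simp

lemma q_power_ne_minus_1:
  assumes "j > 0"
  shows "q ^ j \<noteq> - 1"
proof
  assume "q ^ j = - 1"
  then have "q ^ (j * 2) = 1"
    by (simp add: power_mult)
  then show False
    using not_root_of_unity[of "j * 2"] assms by simp
qed

lemma q_poch_q_nonzero: "q_poch q q m \<noteq> 0"
proof (induction m)
  case (Suc m)
  then show ?case
    using not_root_of_unity[of "Suc m"] by (auto simp: q_poch_Suc power_commutes)
qed simp

lemma q_poch_minus_nonzero: "q_poch (- q) q m \<noteq> 0"
proof (induction m)
  case (Suc m)
  have "1 + q ^ Suc m \<noteq> 0"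
    using q_power_ne_minus_1[of "Suc m"] by (simp add: eq_neg_iff_add_eq_0 add.commute)
  then show ?case
    using Suc.IH by (simp add: q_poch_Suc power_commutes)
qed simp

lemma q_poch_square_nonzero: "q_poch (q\<^sup>2) (q\<^sup>2) m \<noteq> 0"
  by (simp add: q_poch_q_nonzero q_poch_minus_nonzero flip: q_poch_mult_minus)

lemma cheb_U_coeff_closed:
  "cheb_U_coeff q (2 * k + r) k
     = q ^ (k\<^sup>2) * q_poch (q\<^sup>2) (q\<^sup>2) (k + r) / (q_poch (q\<^sup>2) (q\<^sup>2) k * q_poch q q r)"
proof -
  have "(\<Prod>j = k + 1..k + r. 1 + q ^ j) = q_poch (- q) q (k + r) / q_poch (- q) q k"
    using prod_one_plus_power[of k "k + r" q] q_poch_minus_nonzero[of k]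
    by (simp add: field_simps)
  then show ?thesis
    using q_poch_q_nonzero q_poch_minus_nonzero
    by (simp add: cheb_U_coeff_def q_binom_def mult_ac flip: q_poch_mult_minus)
qed

text \<open>
  At \<open>r = 0\<close> both sides vanish: the degree \<open>n - 1 = 2 * k - 1\<close> is too small for a \<open>k\<close>-th term.
\<close>

lemma cheb_U_coeff_pred:
  assumes "n = 2 * k + r" and "n > 0"
  shows "cheb_U_coeff q (n - 1) k
     = q ^ (k\<^sup>2) * q_poch (q\<^sup>2) (q\<^sup>2) (k + r - 1) / (q_poch (q\<^sup>2) (q\<^sup>2) k * q_poch q q r) * (1 - q ^ r)"
proof (cases r)
  case 0
  then show ?thesis
    using assms by (simp add: cheb_U_coeff_def q_binom_def)
next
  case (Suc l)
  have "1 - q * q ^ l \<noteq> 0"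
    using not_root_of_unity[of "Suc l"] by auto
  then show ?thesis
    using assms Suc cheb_U_coeff_closed[of k l] by (simp add: q_poch_Suc power_commutes)
qed

lemma cheb_U_coeff_shifted:
  assumes "n = 2 * Suc k + r"
  shows "q ^ (2 * k + 1) * cheb_U_coeff q (n - 1) k * q_int q (n - 1 - 2 * k)
     = q ^ ((Suc k)\<^sup>2) * q_poch (q\<^sup>2) (q\<^sup>2) (Suc k + r - 1)
         / (q_poch (q\<^sup>2) (q\<^sup>2) (Suc k) * q_poch q q r)
         * ((1 - q ^ (2 * (Suc k + r))) * (1 - q ^ (2 * Suc k)) / (1 - q))"
proof -
  let ?E = "q_poch (q\<^sup>2) (q\<^sup>2)"
  have E_Suc: "?E (Suc j) = ?E j * (1 - q ^ (2 * Suc j))" for j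
    by (simp only: q_poch_Suc power_mult power_Suc mult.commute[of "q\<^sup>2"])
  have "q ^ (2 * k + 1) * q ^ (k\<^sup>2) = q ^ ((Suc k)\<^sup>2)"
    by (subst power_add[symmetric], rule arg_cong[of _ _ "power q"]) (simp add: power2_eq_square)
  moreover have "cheb_U_coeff q (n - 1) k
      = q ^ (k\<^sup>2) * (?E (k + r) * (1 - q ^ (2 * (Suc k + r))))
          / (?E k * (q_poch q q r * (1 - q ^ Suc r)))"
    using cheb_U_coeff_closed[of k "Suc r"] assms E_Suc[of "k + r"]
    by (simp add: q_poch_Suc power_commutes)
  moreover have "q_int q (n - 1 - 2 * k) = (1 - q ^ Suc r) / (1 - q)"
    using assms by (simp add: q_int_def)
  moreover have "1 - q ^ Suc r \<noteq> 0" "1 - q ^ (2 * Suc k) \<noteq> 0"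
    using not_root_of_unity[of "Suc r"] not_root_of_unity[of "2 * Suc k"] by auto
  moreover have "u * (v * (C * d) / (f * (g * w))) * (w / h) = (u * v) * C / (f * z * g) * (d * z / h)"
    if "w \<noteq> 0" "z \<noteq> 0" for u v C d f g h w z :: 'a
    using that by (simp add: divide_simps)
  ultimately show ?thesis
    unfolding E_Suc by (metis add_Suc diff_Suc_1)
qed

text \<open>
  The factor \<open>(-q ^ (n - k); q)_k\<close> in the denominator of \<open>T\<close> is the tail of \<open>(-q; q)_(n - 1)\<close>;
  what remains, \<open>(-q; q)_(n - k - 1) / (-q; q)_k\<close>, is correct for \<open>n = 2 * k\<close> as well.
\<close>

lemma cheb_T_coeff_closed:
  assumes "n = 2 * k + r" and "n > 0"
  shows "cheb_T_coeff q n k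
     = q ^ (k\<^sup>2) * q_poch (q\<^sup>2) (q\<^sup>2) (k + r - 1) / (q_poch (q\<^sup>2) (q\<^sup>2) k * q_poch q q r) * (1 - q ^ n)"
proof -
  obtain l where l: "k + r = Suc l"
    using assms by (cases "k + r") auto
  have nk: "n - k = Suc l" and n1: "n - 1 = l + k" and r: "Suc l - k = r" and kl: "k \<le> Suc l"
    using assms l by auto
  have split: "q_poch (- q) q (l + k) = q_poch (- q) q l * q_poch (- (q ^ Suc l)) q k"
    by (simp add: q_poch_add mult.commute)
  have tail: "q_poch (- (q ^ Suc l)) q k \<noteq> 0"
    using q_poch_minus_nonzero[of "l + k"] unfolding split by simp
  have "q_poch q q (Suc l) = q_poch q q l * (1 - q ^ Suc l)"
    by (simp add: q_poch_Suc mult.commute)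
  then have "cheb_T_coeff q n k
      = q ^ (k\<^sup>2) * ((1 - q ^ n) / (1 - q) / ((1 - q ^ Suc l) / (1 - q)))
          * (q_poch q q l * (1 - q ^ Suc l) / (q_poch q q k * q_poch q q r))
          * (q_poch (- q) q l * q_poch (- (q ^ Suc l)) q k
              / (q_poch (- q) q k * q_poch (- (q ^ Suc l)) q k))"
    unfolding cheb_T_coeff_def nk n1 split q_binom_def q_int_def r using kl by simp
  also have "\<dots> = q ^ (k\<^sup>2) * (q_poch q q l * q_poch (- q) q l)
      / (q_poch q q k * q_poch (- q) q k * q_poch q q r) * (1 - q ^ n)"
  proof -
    have "A * (N / h / (w / h)) * (B * w / (C * g)) * (v * W / (f * W))
        = A * (B * v) / (C * f * g) * N" if "h \<noteq> 0" "w \<noteq> 0" "W \<noteq> 0" for A B C N f g h v w W :: 'a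
      using that by (simp add: divide_simps)
    moreover have "1 - q \<noteq> 0" "1 - q ^ Suc l \<noteq> 0"
      using q_ne_1 not_root_of_unity[of "Suc l"] by auto
    ultimately show ?thesis
      using tail by blast
  qed
  finally show ?thesis
    unfolding q_poch_mult_minus l by simp
qed

section \<open>The identity over a field\<close>

text \<open>
  The first summand gathers \<open>x\<^sup>2 * D U\<close> and \<open>q ^ (n - 1) * x * U\<close>, the second one
  \<open>q * s * D U\<close>, whose extra \<open>s\<close> raises the index by one and so leaves position 0 empty.
\<close>

lemma coefficient_identity:
  assumes "n = 2 * k + r" and "n > 0"
  shows "cheb_U_coeff q (n - 1) k * (q ^ (2 * k) * q_int q (n - 1 - 2 * k) + q ^ (n - 1))
       + (if k = 0 then 0 else
            q ^ (2 * (k - 1) + 1) * cheb_U_coeff q (n - 1) (k - 1) * q_int q (n - 1 - 2 * (k - 1)))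
       = q_int q n * cheb_T_coeff q n k"
proof -
  define G where "G = q ^ (k\<^sup>2) * q_poch (q\<^sup>2) (q\<^sup>2) (k + r - 1)
                        / (q_poch (q\<^sup>2) (q\<^sup>2) k * q_poch q q r)"
  have "(1 - q ^ r) * (q ^ (2 * k) * q_int q (n - 1 - 2 * k) + q ^ (n - 1))
      = (1 - q ^ r) * (q ^ (2 * k) * ((1 - q ^ r) / (1 - q)))"
  proof (cases r)
    case (Suc l)
    then have "q ^ (2 * k) * q_int q (n - 1 - 2 * k) + q ^ (n - 1)
             = q ^ (2 * k) * ((1 - q ^ r) / (1 - q))"
      using assms q_ne_1 by (simp add: q_int_def power_add field_simps)
    then show ?thesis by simp
  qed simp
  then have "cheb_U_coeff q (n - 1) k * (q ^ (2 * k) * q_int q (n - 1 - 2 * k) + q ^ (n - 1))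
      = G * (q ^ (2 * k) * (1 - q ^ r)\<^sup>2 / (1 - q))"
    unfolding cheb_U_coeff_pred[OF assms] G_def[symmetric]
    by (simp add: mult.assoc) (simp add: power2_eq_square)
  moreover have "(if k = 0 then 0 else
        q ^ (2 * (k - 1) + 1) * cheb_U_coeff q (n - 1) (k - 1) * q_int q (n - 1 - 2 * (k - 1)))
      = G * ((1 - q ^ (2 * (k + r))) * (1 - q ^ (2 * k)) / (1 - q))"
  proof (cases k)
    case (Suc l)
    show ?thesis
      using cheb_U_coeff_shifted[of n l r] assms Suc unfolding G_def by simp
  qed simp
  moreover have "q ^ (2 * k) * (1 - q ^ r)\<^sup>2 + (1 - q ^ (2 * (k + r))) * (1 - q ^ (2 * k))
      = (1 - q ^ n)\<^sup>2"
  proof -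
    have "a\<^sup>2 * (1 - b)\<^sup>2 + (1 - (a * b)\<^sup>2) * (1 - a\<^sup>2) = (1 - a\<^sup>2 * b)\<^sup>2" for a b :: 'a
      by (simp add: algebra_simps power2_eq_square)
    from this[of "q ^ k" "q ^ r"] show ?thesis
      unfolding assms(1) by (simp add: power_add power_even_eq power_mult_distrib)
  qed
  moreover have "G * (y / h) + G * (z / h) = w / h * (G * w)" if "y + z = w\<^sup>2" for h w y z
  proof -
    have "G * (y / h) + G * (z / h) = G * ((y + z) / h)"
      by (simp only: distrib_left add_divide_distrib)
    then show ?thesis
      by (simp add: that power2_eq_square)
  qed
  ultimately show ?thesis
    unfolding cheb_T_coeff_closed[OF assms] G_def[symmetric] q_int_def[of q n] by simp
qed

lemma q_cheb_U_deriv_identity: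
  assumes "x \<noteq> 0" and "n > 0"
  shows "(x\<^sup>2 + q * s) * q_deriv q (\<lambda>y. q_cheb_U (n - 1) y (q\<^sup>2 * s) q) x
           + q ^ (n - 1) * x * q_cheb_U (n - 1) x s q
         = q_int q n * q_cheb_T n x s q"
proof -
  define M where "M = n div 2"
  define u where "u = cheb_U_coeff q (n - 1)"
  define e where "e k = n - 1 - 2 * k" for k
  define a where "a k = u k * q ^ (2 * k) * q_int q (e k)" for k
  \<comment> \<open>Position \<open>k\<close> collects what \<open>q * s\<close> moves up from position \<open>k - 1\<close>.\<close>
  define b where "b k = (if k = 0 then 0 else
    q ^ (2 * (k - 1) + 1) * u (k - 1) * q_int q (e (k - 1)))" for k
  have M: "(n - 1) div 2 \<le> M"
    unfolding M_def by (simp add: div_le_mono)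
  have U: "q_cheb_U (n - 1) y t q = (\<Sum>k\<le>M. u k * t ^ k * y ^ e k)" for y t
    using q_cheb_U_eq_sum[OF M] by (simp add: u_def e_def)
  have D: "q_deriv q (\<lambda>y. q_cheb_U (n - 1) y (q\<^sup>2 * s) q) x = (\<Sum>k\<le>M. a k * s ^ k * x ^ (e k - 1))"
    unfolding U q_deriv_sum_powers[OF q_ne_1 assms(1)] a_def
    by (simp add: power_mult_distrib mult_ac flip: power_mult)
  have "x\<^sup>2 * q_deriv q (\<lambda>y. q_cheb_U (n - 1) y (q\<^sup>2 * s) q) x
      = (\<Sum>k\<le>M. a k * s ^ k * x ^ (n - 2 * k))"
    unfolding D sum_distrib_left
  proof (rule sum.cong)
    fix k
    show "x\<^sup>2 * (a k * s ^ k * x ^ (e k - 1)) = a k * s ^ k * x ^ (n - 2 * k)"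
    proof (cases "e k")
      case (Suc l)
      then have "n - 2 * k = 2 + l"
        by (simp add: e_def)
      then show ?thesis
        using Suc by (simp add: power2_eq_square)
    qed (simp add: a_def)
  qed simp
  moreover have "q * s * q_deriv q (\<lambda>y. q_cheb_U (n - 1) y (q\<^sup>2 * s) q) x
      = (\<Sum>k\<le>M. b k * s ^ k * x ^ (n - 2 * k))"
  proof -
    have "q * s * (\<Sum>k\<le>M. a k * s ^ k * x ^ (e k - 1))
        = (\<Sum>k\<le>M. b (Suc k) * s ^ Suc k * x ^ (n - 2 * Suc k))"
      unfolding sum_distrib_left
    proof (rule sum.cong)
      fix k
      have "e k - 1 = n - 2 * Suc k"
        by (simp add: e_def)
      then show "q * s * (a k * s ^ k * x ^ (e k - 1)) = b (Suc k) * s ^ Suc k * x ^ (n - 2 * Suc k)"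
        by (simp add: a_def b_def mult_ac)
    qed simp
    also have "\<dots> = (\<Sum>k\<le>Suc M. b k * s ^ k * x ^ (n - 2 * k))"
      by (subst sum.atMost_Suc_shift) (simp add: b_def)
    also have "\<dots> = (\<Sum>k\<le>M. b k * s ^ k * x ^ (n - 2 * k))"
    proof -
      \<comment> \<open>The extra term differentiates a power of exponent 0.\<close>
      have "e M = 0"
        by (auto simp: e_def M_def)
      then show ?thesis
        by (simp add: b_def)
    qed
    finally show ?thesis
      unfolding D .
  qed
  moreover have "q ^ (n - 1) * x * q_cheb_U (n - 1) x s q
      = (\<Sum>k\<le>M. u k * q ^ (n - 1) * s ^ k * x ^ (n - 2 * k))"
    unfolding U sum_distrib_left
  proof (rule sum.cong)
    fix k
    show "q ^ (n - 1) * x * (u k * s ^ k * x ^ e k) = u k * q ^ (n - 1) * s ^ k * x ^ (n - 2 * k)"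
    proof (cases "n \<le> 2 * k")
      \<comment> \<open>Here \<open>n - 2 * k\<close> and \<open>e k\<close> are both truncated to 0, so the powers of \<open>x\<close> disagree.\<close>
      case True
      then have "u k = 0"
        using assms by (simp add: u_def cheb_U_coeff_def q_binom_def)
      then show ?thesis by simp
    next
      case False
      then have "n - 2 * k = Suc (e k)"
        by (simp add: e_def)
      then show ?thesis by (simp add: mult_ac)
    qed
  qed simp
  moreover
  have "(a k + b k + u k * q ^ (n - 1)) * s ^ k * x ^ (n - 2 * k)
      = q_int q n * (cheb_T_coeff q n k * s ^ k * x ^ (n - 2 * k))" if "k \<le> M" for k
  proof -
    have "n = 2 * k + (n - 2 * k)"
      using that by (simp add: M_def)
    from coefficient_identity[OF this assms(2)]
    have "a k + b k + u k * q ^ (n - 1) = q_int q n * cheb_T_coeff q n k"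
      unfolding a_def b_def u_def e_def by (simp only: distrib_left ac_simps)
    then show ?thesis
      by (simp only: mult.assoc)
  qed
  then have "(\<Sum>k\<le>M. (a k + b k + u k * q ^ (n - 1)) * s ^ k * x ^ (n - 2 * k))
      = q_int q n * q_cheb_T n x s q"
    unfolding q_cheb_T_eq_sum[OF assms(2)] M_def[symmetric] sum_distrib_left
    by (intro sum.cong) auto
  ultimately show ?thesis
    by (simp add: distrib_right sum.distrib)
qed

end

section \<open>The identity for indeterminates\<close>

lemma x_ind_nonzero: "(x_ind :: 'a::field poly poly poly fract) \<noteq> 0"
  by (simp add: x_ind_def)

lemma q_ind_not_root_of_unity:
  assumes "j > 0"
  shows "(q_ind :: 'a::field poly poly poly fract) ^ j \<noteq> 1"
proof
  define p :: "'a poly" where "p = [:0, 1:]"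
  assume "(q_ind :: 'a poly poly poly fract) ^ j = 1"
  moreover have "(q_ind :: 'a poly poly poly fract) ^ j = to_fract ([:[:p:]:] ^ j)"
    unfolding q_ind_def p_def by (induction j) (simp_all del: mult_pCons_left)
  ultimately have "[:[:p:]:] ^ j = 1"
    by (metis to_fract_1 to_fract_eq_iff)
  then have "[:[:p ^ j:]:] = [:[:1:]:]"
    by (simp add: poly_const_pow one_pCons)
  then have "degree (p ^ j) = 0"
    by simp
  then show False
    using assms by (simp add: p_def degree_power_eq)
qed

theorem theorem5p8:
  fixes n :: nat and x s q :: "'a::field poly poly poly fract"
  assumes "x = x_ind" and "s = s_ind" and "q = q_ind"
    and "n \<ge> 1"
  shows "(x\<^sup>2 + q * s) * q_deriv q (\<lambda>y. q_cheb_U (n - 1) y (q\<^sup>2 * s) q) x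
           + q ^ (n - 1) * x * q_cheb_U (n - 1) x s q
         = q_int q n * q_cheb_T n x s q"
proof (rule q_cheb_U_deriv_identity)
  show "q ^ j \<noteq> 1" if "j > 0" for j
    using q_ind_not_root_of_unity[OF that] assms by simp
  show "x \<noteq> 0"
    using x_ind_nonzero assms by simp
  show "n > 0"
    using assms by simp
qed

end
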